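(* Let $X$ be a real normed space and let $K\subset X$ be a convex body. Then for all $\mathbf{x}\in X\setminus K$ we have $\sigma(K,\mathbf{x})=\varrho(K,\mathbf{x})$.
   Context: $X$ is a real normed space, $X\neq\{0\}$, with unit sphere $S$. A convex body is a bounded, closed, convex set with nonempty interior. For $\mathbf{x}\in X$ let $\mathcal{L}=\mathcal{L}(K,\mathbf{x})$ be the set of straight lines $l=\{\mathbf{x}+t\mathbf{v}:t\in\mathbb{R}\}$, $\mathbf{v}\in S$, that meet $K$ in more than one point; for $l\in\mathcal{L}$ write $K\cap l=[\mathbf{a},\mathbf{b}]$, $\mathbf{a}\neq\mathbf{b}$, with endpoints labelled so that $\|\mathbf{x}-\mathbf{b}\|\le\|\mathbf{x}-\mathbf{a}\|$. Define $$\sigma(K,\mathbf{x})=\inf_{l\in\mathcal{L}}\frac{\|\mathbf{b}-\mathbf{x}\|}{\|\mathbf{a}-\mathbf{x}\|}\quad(\mathbf{x}\in X),\qquad \varrho(K,\mathbf{x})=\sup\big\{0<\lambda<1: K\cap\{\mathbf{x}+\lambda(K-\mathbf{x})\}=\emptyset\big\}\quad(\mathbf{x}\notin K).$$ *)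

theory Defs
  imports "HOL-Analysis.Analysis"
begin

definition convex_body :: "'a::real_normed_vector set \<Rightarrow> bool" where
  "convex_body K \<longleftrightarrow> bounded K \<and> closed K \<and> convex K \<and> interior K \<noteq> {}"

definition line_through :: "'a::real_normed_vector \<Rightarrow> 'a \<Rightarrow> 'a set" where
  "line_through x v = {x + t *\<^sub>R v |t. True}"

definition secant_lines :: "'a::real_normed_vector set \<Rightarrow> 'a \<Rightarrow> 'a set set" where
  "secant_lines K x =
     {l. (\<exists>v \<in> sphere 0 1. l = line_through x v) \<and>
         (\<exists>p \<in> K \<inter> l. \<exists>q \<in> K \<inter> l. p \<noteq> q)}"

(* If both labellings of the endpoints satisfy the norm condition, the ratio is 1 for
   either of them, so each line contributes a single value. *)
definition sigma_ratio :: "'a::real_normed_vector set \<Rightarrow> 'a \<Rightarrow> real" where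
  "sigma_ratio K x =
     Inf {norm (b - x) / norm (a - x) |l a b.
            l \<in> secant_lines K x \<and> K \<inter> l = closed_segment a b \<and> a \<noteq> b \<and>
            norm (x - b) \<le> norm (x - a)}"

(* Intended for x outside K; for a convex body K the set is then nonempty, and it is
   always bounded above by 1, so the real-valued Sup is the genuine supremum. *)
definition varrho :: "'a::real_normed_vector set \<Rightarrow> 'a \<Rightarrow> real" where
  "varrho K x =
     Sup {r. 0 < r \<and> r < 1 \<and> K \<inter> (\<lambda>y. x + r *\<^sub>R (y - x)) ` K = {}}"

end

theory Submission
  imports Defs
begin

text \<open>
  Both quantities are governed by the set of \<^emph>\<open>contact ratios\<close>: those \<open>r \<in> (0,1)\<close> for which the
  copy of \<open>K\<close> shrunk towards \<open>x\<close> by the factor \<open>r\<close> still meets \<open>K\<close>.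

  Concerning \<open>\<varrho>\<close>: by convexity the contact ratios form an upper section of \<open>(0,1)\<close>
  (\<open>contact_ratios_upward\<close>), and \<open>\<varrho>\<close> is the supremum of the complementary lower section. Both
  sections are nonempty, so \<open>\<varrho>\<close> is the infimum of the contact ratios (\<open>varrho_eq_Inf\<close>).

  Concerning \<open>\<sigma>\<close>: a contact between \<open>K\<close> and its shrunk copy consists of two points of \<open>K\<close> on one
  ray from \<open>x\<close>, the ratio of whose distances to \<open>x\<close> is \<open>r\<close>. The endpoints of a chord are such a
  pair, so every chord ratio is a contact ratio (\<open>chord_ratio_is_contact_ratio\<close>). Conversely, a pair
  with ratio \<open>r\<close> lies on a chord; passing to the endpoints of the chord moves the near point nearer
  and the far point farther, so the ratio of the chord is at most \<open>r\<close>
  (\<open>chord_ratio_le_contact_ratio\<close>). Hence the two sets have the same infimum.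
\<close>

section \<open>Contact ratios of a convex body\<close>

definition contact_ratios :: "'a::real_normed_vector set \<Rightarrow> 'a \<Rightarrow> real set" where
  "contact_ratios K x = {r. 0 < r \<and> r < 1 \<and> (\<exists>y\<in>K. x + r *\<^sub>R (y - x) \<in> K)}"

lemma bdd_below_contact_ratios: "bdd_below (contact_ratios K x)"
  by (rule bdd_belowI[of _ 0]) (auto simp: contact_ratios_def)

text \<open>
  If \<open>y\<close> and its image under the homothety with centre \<open>x\<close> and ratio \<open>r\<close> both lie in \<open>K\<close>, then so
  does the segment between them, which contains the images of \<open>y\<close> for all ratios in \<open>[r,1]\<close>.
\<close>

lemma contact_ratios_upward:
  assumes "convex K" "r \<in> contact_ratios K x" "r \<le> s" "s < 1"
  shows "s \<in> contact_ratios K x"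
proof -
  obtain y where r: "0 < r" "r < 1" and y: "y \<in> K" "x + r *\<^sub>R (y - x) \<in> K"
    using assms(2) by (auto simp: contact_ratios_def)
  define t where "t = (1 - s) / (1 - r)"
  have t: "0 \<le> t" "t \<le> 1" and tr: "t * (1 - r) = 1 - s"
    using r assms(3,4) by (auto simp: t_def)
  have "(1 - t) *\<^sub>R y + t *\<^sub>R (x + r *\<^sub>R (y - x)) \<in> K"
    using convexD_alt[OF assms(1) y t] .
  moreover have "(1 - t) *\<^sub>R y + t *\<^sub>R (x + r *\<^sub>R (y - x)) = x + (1 - t * (1 - r)) *\<^sub>R (y - x)"
    by (simp add: algebra_simps)
  ultimately have "x + s *\<^sub>R (y - x) \<in> K"
    by (simp add: tr)
  then show ?thesis
    using r assms(3,4) y(1) by (auto simp: contact_ratios_def)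
qed

text \<open>
  An interior point \<open>p\<close> of \<open>K\<close> can be pushed slightly away from \<open>x\<close> without leaving \<open>K\<close>.
\<close>

lemma contact_ratios_nonempty:
  assumes "interior K \<noteq> {}" "x \<notin> K"
  shows "contact_ratios K x \<noteq> {}"
proof -
  obtain p e where e: "0 < e" "ball p e \<subseteq> K"
    using assms(1) by (auto simp: mem_interior)
  have "p \<in> K"
    using e by auto
  then have "p \<noteq> x"
    using assms(2) by auto
  then have n: "0 < norm (p - x)"
    by simp
  define d where "d = e / (2 * norm (p - x))"
  have d: "0 < d" "d * norm (p - x) < e"
    using e(1) n by (auto simp: d_def)
  define y where "y = x + (1 + d) *\<^sub>R (p - x)"
  have "p - y = (- d) *\<^sub>R (p - x)"
    by (simp add: y_def algebra_simps)
  then have "dist p y < e"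
    using d by (simp add: dist_norm)
  then have "y \<in> K"
    using e(2) by auto
  moreover have "x + (1 / (1 + d)) *\<^sub>R (y - x) = p"
    using d(1) by (simp add: y_def)
  ultimately have "1 / (1 + d) \<in> contact_ratios K x"
    using d(1) \<open>p \<in> K\<close> by (auto simp: contact_ratios_def intro!: bexI[of _ y])
  then show ?thesis
    by blast
qed

text \<open>
  A sufficiently small copy of a bounded set near \<open>x\<close> stays inside a ball about \<open>x\<close> that misses the
  closed set \<open>K\<close>.
\<close>

lemma contact_ratios_bounded_away:
  assumes "bounded K" "closed K" "x \<notin> K"
  obtains r where "0 < r" "r < 1" "r \<notin> contact_ratios K x"
proof -
  obtain e where e: "0 < e" "ball x e \<subseteq> - K"
    using assms(2,3) by (metis ComplI open_Compl open_contains_ball)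
  obtain M where M: "\<And>y. y \<in> K \<Longrightarrow> dist x y \<le> M"
    using assms(1) bounded_any_center[of K x] by auto
  define N where "N = max M e + 1"
  define r where "r = e / N"
  have N: "0 < N" "e < N" "M < N"
    using e(1) by (auto simp: N_def)
  have r: "0 < r" "r < 1"
    using N e(1) by (auto simp: r_def)
  have "x + r *\<^sub>R (y - x) \<notin> K" if "y \<in> K" for y
  proof -
    have "dist x y < N"
      using M[OF that] N by simp
    then have "r * dist x y < r * N"
      using r(1) by simp
    moreover have "r * N = e"
      using N(1) by (simp add: r_def)
    moreover have "dist x (x + r *\<^sub>R (y - x)) = r * dist x y"
      using r(1) by (simp add: dist_norm norm_minus_commute)
    ultimately have "x + r *\<^sub>R (y - x) \<in> ball x e"
      by simp
    then show ?thesis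
      using e(2) by blast
  qed
  then have "r \<notin> contact_ratios K x"
    by (auto simp: contact_ratios_def)
  then show thesis
    using that r by blast
qed

section \<open>The supremum of the homothety ratios without contact\<close>

lemma varrho_eq_Inf:
  assumes "convex_body K" "x \<notin> K"
  shows "varrho K x = Inf (contact_ratios K x)"
proof -
  let ?C = "contact_ratios K x"
  define R where "R = {r. 0 < r \<and> r < 1 \<and> r \<notin> ?C}"
  have K: "bounded K" "closed K" "convex K" "interior K \<noteq> {}"
    using assms(1) by (auto simp: convex_body_def)
  have C: "?C \<noteq> {}"
    using contact_ratios_nonempty[OF K(4) assms(2)] .
  obtain r0 where r0: "r0 \<in> R"
    using contact_ratios_bounded_away[OF K(1,2) assms(2)] by (auto simp: R_def)
  have R_below_C: "r \<le> c" if "r \<in> R" "c \<in> ?C" for r c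
  proof (rule ccontr)
    assume "\<not> r \<le> c"
    then have "r \<in> ?C"
      using contact_ratios_upward[OF K(3) that(2), of r] that(1) by (auto simp: R_def)
    then show False
      using that(1) by (simp add: R_def)
  qed
  have "varrho K x = Sup R"
    unfolding varrho_def R_def contact_ratios_def
    by (rule arg_cong[where f = Sup]) auto
  also have "Sup R = Inf ?C"
  proof (rule antisym)
    show "Sup R \<le> Inf ?C"
      using r0 C R_below_C by (intro cSup_least cInf_greatest) auto
    show "Inf ?C \<le> Sup R"
    proof (rule ccontr)
      assume "\<not> Inf ?C \<le> Sup R"
      then obtain m where m: "Sup R < m" "m < Inf ?C"
        by (meson dense not_le)
      have bdd: "bdd_above R"
        by (rule bdd_aboveI[of _ 1]) (auto simp: R_def)
      have "0 < m"
        using cSup_upper[OF r0 bdd] m(1) r0 by (auto simp: R_def)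
      moreover have "m \<notin> ?C"
        using m(2) cInf_lower[OF _ bdd_below_contact_ratios, of m K x] by auto
      moreover have "m < 1"
      proof -
        obtain c where "c \<in> ?C"
          using C by auto
        then show ?thesis
          using m(2) cInf_lower[OF _ bdd_below_contact_ratios, of c K x]
          by (auto simp: contact_ratios_def)
      qed
      ultimately have "m \<in> R"
        by (simp add: R_def)
      then show False
        using cSup_upper[OF _ bdd] m(1) by force
    qed
  qed
  finally show ?thesis .
qed

section \<open>Chords and their ratios\<close>

definition chord_ratios :: "'a::real_normed_vector set \<Rightarrow> 'a \<Rightarrow> real set" where
  "chord_ratios K x =
     {norm (b - x) / norm (a - x) |l a b.
        l \<in> secant_lines K x \<and> K \<inter> l = closed_segment a b \<and> a \<noteq> b \<and>
        norm (x - b) \<le> norm (x - a)}"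

text \<open>
  Since \<open>x\<close> lies on the line of the chord but not on the chord, the endpoints are on the same side
  of \<open>x\<close>; hence the nearer one is the image of the farther one under a homothety with centre \<open>x\<close>
  whose ratio is the ratio of their distances to \<open>x\<close>.
\<close>

lemma chord_ratio_is_contact_ratio:
  assumes "x \<notin> K" "c \<in> chord_ratios K x"
  shows "c \<in> contact_ratios K x"
proof -
  obtain l a b where l: "l \<in> secant_lines K x" and seg: "K \<inter> l = closed_segment a b"
    and ab: "a \<noteq> b" and le: "norm (x - b) \<le> norm (x - a)"
    and c: "c = norm (b - x) / norm (a - x)"
    using assms(2) by (auto simp: chord_ratios_def)
  obtain v where v: "norm v = 1" "l = line_through x v"
    using l by (auto simp: secant_lines_def)
  have mem: "a \<in> K" "b \<in> K" "a \<in> l" "b \<in> l"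
    using seg ends_in_segment[of a b] by blast+
  obtain s t where s: "a = x + s *\<^sub>R v" and t: "b = x + t *\<^sub>R v"
    using mem v by (auto simp: line_through_def)
  have "x \<in> l"
    using v by (auto simp: line_through_def intro!: exI[of _ 0])
  then have x_notin: "x \<notin> closed_segment a b"
    using seg assms(1) by blast
  have nz: "s \<noteq> 0" "t \<noteq> 0" "s \<noteq> t"
    using s t mem(1,2) assms(1) ab by auto
  have "\<bar>t\<bar> \<le> \<bar>s\<bar>"
    using le by (simp add: s t v)
  have cst: "c = \<bar>t\<bar> / \<bar>s\<bar>"
    by (simp add: c s t v)
  have pos: "0 < t / s"
  proof (rule ccontr)
    assume "\<not> 0 < t / s"
    then have neg: "t / s < 0"
      using nz by (metis divide_eq_0_iff linorder_neqE_linordered_idom)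
    \<comment> \<open>Otherwise \<open>0\<close> lies between the parameters \<open>s\<close> and \<open>t\<close>, so \<open>x\<close> lies on the chord.\<close>
    define u where "u = s / (s - t)"
    have u: "0 \<le> u" "u \<le> 1"
      using neg nz by (auto simp: u_def divide_simps split: if_splits)
    have "(1 - u) * s + u * t = 0"
      using nz by (simp add: u_def field_simps)
    moreover have "(1 - u) *\<^sub>R a + u *\<^sub>R b = x + ((1 - u) * s + u * t) *\<^sub>R v"
      by (simp add: s t algebra_simps)
    ultimately have "x = (1 - u) *\<^sub>R a + u *\<^sub>R b"
      by simp
    then show False
      using x_notin u by (auto simp: closed_segment_def)
  qed
  have c_eq: "c = t / s"
    using cst pos by (metis abs_divide abs_of_pos)
  have "c \<le> 1"
    using \<open>\<bar>t\<bar> \<le> \<bar>s\<bar>\<close> nz(1) cst by simp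
  moreover have "c \<noteq> 1"
    using nz c_eq by auto
  ultimately have "c < 1"
    by simp
  moreover have "x + c *\<^sub>R (a - x) \<in> K"
    using nz mem(2) by (simp add: c_eq s t)
  ultimately show ?thesis
    using pos mem(1) by (auto simp: contact_ratios_def c_eq)
qed

text \<open>
  The line through \<open>x\<close>, \<open>y\<close> and the image of \<open>y\<close> is parametrised as \<open>x + t *\<^sub>R (y - x)\<close> with
  unnormalised direction, so that the two known points of \<open>K\<close> have the parameters \<open>1\<close> and \<open>r\<close> and a
  chord with parameter interval \<open>[p,q]\<close> has ratio \<open>p / q \<le> r / 1\<close>. The parameters form a compact
  interval even where \<open>K\<close> is not compact.
\<close>

lemma chord_ratio_le_contact_ratio:
  assumes "bounded K" "closed K" "convex K" "x \<notin> K" "r \<in> contact_ratios K x"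
  obtains c where "c \<in> chord_ratios K x" "c \<le> r"
proof -
  obtain y where r: "0 < r" "r < 1" and y: "y \<in> K" "x + r *\<^sub>R (y - x) \<in> K"
    using assms(5) by (auto simp: contact_ratios_def)
  define w where "w = y - x"
  have w: "w \<noteq> 0"
    using y(1) assms(4) by (auto simp: w_def)
  define f where "f = (\<lambda>t. x + t *\<^sub>R w)"
  define T where "T = f -` K"
  have T1: "1 \<in> T" and Tr: "r \<in> T" and T0: "0 \<notin> T"
    using y assms(4) by (auto simp: T_def f_def w_def)
  have "closed T"
    unfolding T_def f_def by (intro closed_vimage assms(2) continuous_intros)
  moreover have "bounded T"
  proof -
    obtain M where M: "\<And>z. z \<in> K \<Longrightarrow> dist x z \<le> M"
      using assms(1) bounded_any_center[of K x] by auto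
    have "\<bar>t\<bar> \<le> M / norm w" if "t \<in> T" for t
      using M[of "f t"] that w by (simp add: T_def f_def dist_norm pos_le_divide_eq)
    then show ?thesis
      by (auto simp: bounded_iff)
  qed
  ultimately have "compact T"
    by (simp add: compact_eq_bounded_closed)
  moreover have "convex T"
    unfolding convex_alt
  proof (intro ballI allI impI)
    fix s t u :: real
    assume st: "s \<in> T" "t \<in> T" and u: "0 \<le> u \<and> u \<le> 1"
    have "(1 - u) *\<^sub>R f s + u *\<^sub>R f t \<in> K"
      using st u convexD_alt[OF assms(3)] by (auto simp: T_def)
    moreover have "(1 - u) *\<^sub>R f s + u *\<^sub>R f t = f ((1 - u) *\<^sub>R s + u *\<^sub>R t)"
      by (simp add: f_def algebra_simps)
    ultimately show "(1 - u) *\<^sub>R s + u *\<^sub>R t \<in> T"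
      by (simp add: T_def)
  qed
  ultimately obtain p q where pq: "T = {p..q}"
    using connected_compact_interval_1[of T] convex_connected by auto
  have bounds: "p \<le> r" "1 \<le> q" "0 < p"
    using T1 Tr T0 r(1) by (auto simp: pq)
  define v where "v = (1 / norm w) *\<^sub>R w"
  have l_eq: "line_through x v = range f"
  proof -
    have "f t = x + (t * norm w) *\<^sub>R v" "x + t *\<^sub>R v = f (t / norm w)" for t
      using w by (auto simp: f_def v_def)
    then show ?thesis
      unfolding line_through_def by blast
  qed
  have "f 1 \<noteq> f r"
    using w r(2) scaleR_cancel_right[of 1 w r] by (auto simp: f_def)
  moreover have "f 1 \<in> K \<inter> range f" "f r \<in> K \<inter> range f"
    using T1 Tr by (auto simp: T_def)
  moreover have "v \<in> sphere 0 1"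
    using w by (simp add: v_def)
  ultimately have secant: "range f \<in> secant_lines K x"
    unfolding secant_lines_def using l_eq by blast
  have "K \<inter> range f = f ` T"
    by (auto simp: T_def)
  also have "\<dots> = closed_segment (f q) (f p)"
  proof -
    have "T = closed_segment q p"
      using bounds r(2) by (simp add: pq closed_segment_eq_real_ivl)
    moreover have "f ((1 - u) *\<^sub>R q + u *\<^sub>R p) = (1 - u) *\<^sub>R f q + u *\<^sub>R f p" for u
      by (simp add: f_def algebra_simps)
    ultimately show ?thesis
      by (simp add: closed_segment_image_interval image_image)
  qed
  finally have seg: "K \<inter> range f = closed_segment (f q) (f p)" .
  have "f q \<noteq> f p" "norm (x - f p) \<le> norm (x - f q)"
    using bounds r(2) w by (auto simp: f_def)
  with secant seg have "norm (f p - x) / norm (f q - x) \<in> chord_ratios K x"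
    unfolding chord_ratios_def by blast
  moreover have "norm (f p - x) / norm (f q - x) = p / q"
    using bounds w by (simp add: f_def)
  moreover have "p / q \<le> r"
    using frac_le[of r p 1 q] bounds r(1) by simp
  ultimately show thesis
    using that by simp
qed

lemma sigma_ratio_eq_Inf:
  assumes "convex_body K" "x \<notin> K"
  shows "sigma_ratio K x = Inf (contact_ratios K x)"
proof -
  let ?C = "contact_ratios K x" and ?Q = "chord_ratios K x"
  have K: "bounded K" "closed K" "convex K" "interior K \<noteq> {}"
    using assms(1) by (auto simp: convex_body_def)
  have C: "?C \<noteq> {}"
    using contact_ratios_nonempty[OF K(4) assms(2)] .
  have sub: "?Q \<subseteq> ?C"
    using chord_ratio_is_contact_ratio[OF assms(2)] by blast
  have dom: "\<exists>c\<in>?Q. c \<le> r" if "r \<in> ?C" for r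
    using chord_ratio_le_contact_ratio[OF K(1-3) assms(2) that] by blast
  have "sigma_ratio K x = Inf ?Q"
    by (simp add: sigma_ratio_def chord_ratios_def)
  also have "\<dots> = Inf ?C"
  proof (rule antisym)
    show "Inf ?Q \<le> Inf ?C"
      using C dom bdd_below_mono[OF bdd_below_contact_ratios sub] by (intro cInf_mono) auto
    show "Inf ?C \<le> Inf ?Q"
      using C dom by (intro cInf_superset_mono bdd_below_contact_ratios sub) auto
  qed
  finally show ?thesis .
qed

theorem proposition4p3:
  fixes K :: "'a::real_normed_vector set"
  assumes "(UNIV :: 'a set) \<noteq> {0}"
    and "convex_body K"
  shows "\<forall>x \<in> UNIV - K. sigma_ratio K x = varrho K x"
  using sigma_ratio_eq_Inf[OF assms(2)] varrho_eq_Inf[OF assms(2)] by simp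

end
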